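(* Let $m\ge 1$ be an integer, let $\zeta\in\mathbb{C}$ be a primitive $m$-th root of unity, and let $a,b$ be nonzero complex numbers with $|ab|<1$. Put $$A_m = a^{m(m+1)/2}\, b^{m(m-1)/2}, \qquad B_m = a^{m(m-1)/2}\, b^{m(m+1)/2}.$$ Then $$ f(\zeta a, \zeta b) = \sum_{k=0}^{m-1} \zeta^{k^2}\, a^{k(k+1)/2}\, b^{k(k-1)/2}\, f\bigl(A_m (ab)^{mk},\, B_m (ab)^{-mk}\bigr). $$
   Context: Ramanujan's theta function is defined, for complex numbers $x,y$ with $|xy|<1$, by $$f(x,y) = \sum_{n=-\infty}^{\infty} x^{n(n+1)/2}\, y^{n(n-1)/2}.$$ *)

theory Defs
  imports "HOL-Analysis.Analysis"
begin

(* The products n (n + 1) and n (n - 1) are even and nonnegative for every integer n, so the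
   exponents are exact nonnegative integers and 0 powi 0 = 1 handles vanishing arguments.
   The bilateral series converges absolutely whenever norm (x * y) < 1, which is the only
   range where the value is meaningful. *)
definition ramanujan_theta :: "complex \<Rightarrow> complex \<Rightarrow> complex" where
  "ramanujan_theta x y =
     (\<Sum>\<^sub>\<infinity>n\<in>(UNIV :: int set). x powi (n * (n + 1) div 2) * y powi (n * (n - 1) div 2))"

definition primitive_root_of_unity :: "nat \<Rightarrow> complex \<Rightarrow> bool" where
  "primitive_root_of_unity m z \<longleftrightarrow>
     m \<ge> 1 \<and> z ^ m = 1 \<and> (\<forall>j. 1 \<le> j \<and> j < m \<longrightarrow> z ^ j \<noteq> 1)"

(* In the next two definitions the truncated subtraction m - 1 is harmless: for m = 0 the factor m
   annihilates it. *)
definition theta_A :: "nat \<Rightarrow> complex \<Rightarrow> complex \<Rightarrow> complex" where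
  "theta_A m a b = a ^ (m * (m + 1) div 2) * b ^ (m * (m - 1) div 2)"

definition theta_B :: "nat \<Rightarrow> complex \<Rightarrow> complex \<Rightarrow> complex" where
  "theta_B m a b = a ^ (m * (m - 1) div 2) * b ^ (m * (m + 1) div 2)"

end

(* Split the bilateral series over n = m r + k with 0 <= k < m. Since \<zeta>^m = 1, the factor
   \<zeta>^(n^2) depends only on k, and the remaining powers of a and b, which are quadratic in r,
   are exactly the general term of the theta function on the right-hand side. Absolute
   convergence justifies the regrouping. *)
theory Submission
  imports Defs
begin

text \<open>Halving is exact because consecutive integers have an even product. The second equation
  lets both exponents of the theta series be expressed through triangular numbers.\<close>

lemma triangle_int:
  fixes n :: int
  shows "2 * (n * (n + 1) div 2) = n * (n + 1)" and "n * (n - 1) div 2 = n * (n + 1) div 2 - n"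
proof -
  show eq: "2 * (n * (n + 1) div 2) = n * (n + 1)"
    by (intro dvd_mult_div_cancel) simp
  have "2 * (n * (n - 1) div 2) = n * (n - 1)"
    by (intro dvd_mult_div_cancel) simp
  with eq show "n * (n - 1) div 2 = n * (n + 1) div 2 - n"
    by (simp add: algebra_simps)
qed

definition theta_term :: "complex \<Rightarrow> complex \<Rightarrow> int \<Rightarrow> complex" where
  "theta_term x y n = x powi (n * (n + 1) div 2) * y powi (n * (n - 1) div 2)"

text \<open>Reflection swaps the two exponents, so the negative half of the bilateral series is a
  positive half with the arguments exchanged.\<close>

lemma theta_term_uminus: "theta_term x y (- n) = theta_term y x n"
proof -
  have "- n * (- n + 1) = n * (n - 1)" "- n * (- n - 1) = n * (n + 1)"
    by (simp_all add: algebra_simps)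
  then show ?thesis
    by (simp add: theta_term_def mult.commute)
qed

text \<open>Both exponents grow linearly from n to n + 1, by n + 1 and by n. The resulting quotient
  tends to 0 when \<open>norm (x * y) < 1\<close>, which feeds the ratio test.\<close>

lemma theta_term_nat_Suc:
  assumes "x \<noteq> 0" "y \<noteq> 0"
  shows "theta_term x y (int (Suc n)) = theta_term x y (int n) * (x * (x * y) ^ n)"
proof -
  have s: "int (Suc n) * (int (Suc n) + 1) div 2 = int n * (int n + 1) div 2 + int (Suc n)"
    using triangle_int(1)[of "int n"] triangle_int(1)[of "int (Suc n)"]
    by (simp add: algebra_simps)
  then have t: "int (Suc n) * (int (Suc n) - 1) div 2 = int n * (int n - 1) div 2 + int n"
    using triangle_int(2)[of "int n"] triangle_int(2)[of "int (Suc n)"] by simp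
  show ?thesis
    unfolding theta_term_def s t using assms
    by (simp add: power_int_add power_int_of_nat power_mult_distrib del: of_nat_Suc)
qed

lemma summable_theta_term_nat:
  assumes "x \<noteq> 0" "y \<noteq> 0" "norm (x * y) < 1"
  shows "summable (\<lambda>n. norm (theta_term x y (int n)))"
proof -
  have "(\<lambda>n. norm x * norm (x * y) ^ n) \<longlonglongrightarrow> norm x * 0"
    using assms(3) by (intro tendsto_intros LIMSEQ_power_zero) simp
  then have "\<forall>\<^sub>F n in sequentially. norm x * norm (x * y) ^ n < 1 / 2"
    by (intro order_tendstoD(2)) auto
  then obtain N where N: "\<And>n. n \<ge> N \<Longrightarrow> norm x * norm (x * y) ^ n < 1 / 2"
    unfolding eventually_sequentially by blast
  show ?thesis
  proof (rule summable_ratio_test)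
    fix n assume "n \<ge> N"
    have "norm (theta_term x y (int (Suc n)))
        = (norm x * norm (x * y) ^ n) * norm (theta_term x y (int n))"
      unfolding theta_term_nat_Suc[OF assms(1,2)] by (simp only: norm_mult norm_power mult_ac)
    also have "\<dots> \<le> 1 / 2 * norm (theta_term x y (int n))"
      using N[OF \<open>n \<ge> N\<close>] by (intro mult_right_mono) auto
    finally show "norm (norm (theta_term x y (int (Suc n))))
        \<le> 1 / 2 * norm (norm (theta_term x y (int n)))"
      by simp
  qed simp
qed

lemma summable_on_theta_term:
  assumes "x \<noteq> 0" "y \<noteq> 0" "norm (x * y) < 1"
  shows "theta_term x y summable_on UNIV"
proof -
  have nat: "(\<lambda>n. theta_term u v (int n)) summable_on UNIV"
    if "u \<noteq> 0" "v \<noteq> 0" "norm (u * v) < 1" for u v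
    using norm_summable_imp_summable_on[OF summable_theta_term_nat[OF that]] .
  have "theta_term x y summable_on range int"
    using nat[OF assms] by (subst summable_on_reindex) (auto simp: o_def)
  moreover have "theta_term x y summable_on range (\<lambda>n. - int n)"
    using nat[of y x] assms
    by (subst summable_on_reindex) (auto simp: o_def theta_term_uminus mult.commute inj_on_def)
  \<comment> \<open>The two half-lines share the index 0; summability on a union tolerates the
    overlap.\<close>
  ultimately have "theta_term x y summable_on (range int \<union> range (\<lambda>n. - int n))"
    by (rule summable_on_union)
  moreover have "range int \<union> range (\<lambda>n. - int n) = UNIV"
    by (auto intro: int_cases2)
  ultimately show ?thesis by simp
qed

text \<open>Division with remainder. The order (k, r) puts the finite index outside when the double
  sum is iterated.\<close>

lemma bij_betw_quot_rem:
  fixes m :: nat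
  assumes "m \<ge> 1"
  shows "bij_betw (\<lambda>(k, r). int m * r + int k) ({..<m} \<times> UNIV) (UNIV :: int set)"
proof (rule bij_betw_byWitness[where f' = "\<lambda>n. (nat (n mod int m), n div int m)"])
  show "(\<lambda>n. (nat (n mod int m), n div int m)) ` UNIV \<subseteq> {..<m} \<times> UNIV"
    using assms by (auto simp: nat_less_iff)
qed (use assms in auto)

lemma theta_term_arith_progression:
  fixes a b z :: complex and m k :: nat and r :: int
  assumes "m \<ge> 1" "z ^ m = 1" and ab: "a \<noteq> 0" "b \<noteq> 0"
  shows "theta_term (z * a) (z * b) (int m * r + int k) =
    z ^ (k ^ 2) * a ^ (k * (k + 1) div 2) * b ^ (k * (k - 1) div 2) *
      theta_term (theta_A m a b * (a * b) powi (int m * int k))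
                 (theta_B m a b * (a * b) powi (- (int m * int k))) r"
proof -
  have z: "z \<noteq> 0"
    using assms(1,2) by (auto simp: power_0_left)
  define s where "s n = n * (n + 1) div 2" for n :: int
  have s2: "2 * s n = n * (n + 1)" for n
    unfolding s_def by (rule triangle_int)
  have t: "n * (n - 1) div 2 = s n - n" for n :: int
    unfolding s_def by (rule triangle_int)
  have pow_s: "x ^ (n * (n + 1) div 2) = x powi s (int n)" for x :: complex and n
    unfolding s_def power_int_of_nat[symmetric] by (simp add: zdiv_int algebra_simps)
  \<comment> \<open>The case n = 0 is separate because the natural subtraction n - 1 truncates
    there; both exponents are then 0.\<close>
  have pow_t: "x ^ (n * (n - 1) div 2) = x powi (s (int n) - int n)" for x :: complex and n
    unfolding t[symmetric] power_int_of_nat[symmetric]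
    by (cases n) (simp_all add: zdiv_int algebra_simps)
  define M K where "M = int m" and "K = int k"
  \<comment> \<open>The quadratic in r is expanded in \<open>s r\<close> and \<open>s r - r\<close>,
    the two exponents of the r-th theta term; the coefficients are the exponents of a in the two new
    arguments. The factor 4 clears the two halvings in products such as
    \<open>s M * s r\<close>.\<close>
  have "4 * s (M * r + K) = 4 * (s K + (s M + M * K) * s r + (s M - M - M * K) * (s r - r))"
    using s2[of "M * r + K"] s2[of K] s2[of M] s2[of r] by algebra
  then have s_split: "s (M * r + K)
      = s K + ((s M + M * K) * s r + (s M - M - M * K) * (s r - r))"
    by simp
  \<comment> \<open>Since r = \<open>s r - (s r - r)\<close>, subtracting \<open>M * r\<close>
    shifts the two coefficients by -M and M, which gives the exponents of b.\<close>
  have t_split: "s (M * r + K) - (M * r + K)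
      = (s K - K) + ((s M - M + M * K) * s r + (s M - M * K) * (s r - r))"
    unfolding s_split by (simp add: algebra_simps)
  \<comment> \<open>The two exponents of the n-th term add up to \<open>2 * s n - n\<close>, that
    is, to the square of n. Isolating a multiple of M in this square lets \<open>z ^ m = 1\<close>
    remove the dependence on r.\<close>
  have "z powi s (M * r + K) * z powi (s (M * r + K) - (M * r + K))
      = z powi ((M * r + K)\<^sup>2)"
    using s2[of "M * r + K"] z
    by (simp add: power_int_add[symmetric] power2_eq_square algebra_simps)
  also have "(M * r + K)\<^sup>2 = M * (M * r\<^sup>2 + 2 * r * K) + K\<^sup>2"
    by (simp add: power2_eq_square algebra_simps)
  also have "z powi \<dots> = z ^ (k\<^sup>2)"
    using z assms(2)
    by (simp add: power_int_add power_int_mult M_def K_def flip: power_int_of_nat)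
  finally have z_part: "z powi s (M * r + K) * z powi (s (M * r + K) - (M * r + K)) = z ^ (k\<^sup>2)" .
  have A: "theta_A m a b * (a * b) powi (M * K)
      = a powi (s M + M * K) * b powi (s M - M + M * K)"
    using ab by (simp add: theta_A_def pow_s pow_t power_int_mult_distrib power_int_add
        flip: M_def del: One_nat_def)
  have B: "theta_B m a b * (a * b) powi (- (M * K))
      = a powi (s M - M - M * K) * b powi (s M - M * K)"
  proof -
    have "theta_B m a b * (a * b) powi (- (M * K))
      = (a powi (s M - M) * a powi (- (M * K))) * (b powi s M * b powi (- (M * K)))"
      unfolding theta_B_def pow_s pow_t power_int_mult_distrib M_def by (simp only: mult_ac)
    then show ?thesis
      using ab by (simp flip: power_int_add)
  qed
  \<comment> \<open>Shaped to match the right-hand sides of \<open>s_split\<close> and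
    \<open>t_split\<close>.\<close>
  have powi_split: "x powi (c + (p * u + q * v)) = x powi c * ((x powi p) powi u * (x powi q) powi v)"
    if "x \<noteq> 0" for x :: complex and c p u q v
    using that by (simp add: power_int_add power_int_mult)
  have "theta_term (z * a) (z * b) (M * r + K)
      = (z powi s (M * r + K) * z powi (s (M * r + K) - (M * r + K)))
        * (a powi s (M * r + K) * b powi (s (M * r + K) - (M * r + K)))"
    unfolding theta_term_def t s_def[symmetric] power_int_mult_distrib by (simp only: mult_ac)
  also have "a powi s (M * r + K) * b powi (s (M * r + K) - (M * r + K))
      = a powi s K * b powi (s K - K)
        * theta_term (a powi (s M + M * K) * b powi (s M - M + M * K))
                     (a powi (s M - M - M * K) * b powi (s M - M * K)) r"
    unfolding t_split unfolding s_split theta_term_def t s_def[symmetric] power_int_mult_distrib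
      powi_split[OF ab(1)] powi_split[OF ab(2)]
    by (simp only: mult_ac)
  finally show ?thesis
    unfolding z_part A[symmetric] B[symmetric]
    unfolding pow_s pow_t M_def K_def
    by (simp only: mult.assoc)
qed

theorem theorem2p1:
  fixes m :: nat and \<zeta> a b :: complex
  assumes "m \<ge> 1"
    and "primitive_root_of_unity m \<zeta>"
    and "a \<noteq> 0" and "b \<noteq> 0"
    and "norm (a * b) < 1"
  shows "ramanujan_theta (\<zeta> * a) (\<zeta> * b) =
    (\<Sum>k<m. \<zeta> ^ (k ^ 2) * a ^ (k * (k + 1) div 2) * b ^ (k * (k - 1) div 2) *
       ramanujan_theta (theta_A m a b * (a * b) powi (int m * int k))
                       (theta_B m a b * (a * b) powi (- (int m * int k))))"
proof -
  have theta: "ramanujan_theta x y = infsum (theta_term x y) UNIV" for x y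
    unfolding ramanujan_theta_def theta_term_def ..
  have root: "\<zeta> ^ m = 1"
    using assms(2) by (simp add: primitive_root_of_unity_def)
  then have "norm \<zeta> = 1"
    using assms(1) power_eq_1_iff[of \<zeta> m] by simp
  let ?t = "theta_term (\<zeta> * a) (\<zeta> * b)"
  let ?h = "\<lambda>(k, r). int m * r + int k"
  note bij = bij_betw_quot_rem[OF assms(1)]
  \<comment> \<open>As \<zeta> has norm 1, the product of the rotated arguments still has norm below
    1.\<close>
  have "?t summable_on UNIV"
    using assms \<open>norm \<zeta> = 1\<close> by (intro summable_on_theta_term) (auto simp: norm_mult)
  then have summable: "(\<lambda>p. ?t (?h p)) summable_on {..<m} \<times> UNIV"
    using summable_on_reindex_bij_betw[OF bij, of ?t] by blast
  have "infsum ?t UNIV = infsum (\<lambda>p. ?t (?h p)) ({..<m} \<times> UNIV)"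
    by (rule infsum_reindex_bij_betw[OF bij, symmetric])
  also have "\<dots> = (\<Sum>k<m. \<Sum>\<^sub>\<infinity>r. ?t (int m * r + int k))"
    using infsum_Sigma_banach[OF summable] by simp
  \<comment> \<open>The factor depending only on k leaves the inner sum by
    \<open>infsum_cmult_right'\<close>, which holds over a field whether or not the series
    converges.\<close>
  finally show ?thesis
    by (simp only: theta theta_term_arith_progression[OF assms(1) root assms(3,4)] infsum_cmult_right')
qed

end
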